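(* Let $r,s$ be positive integers. If $1\le r\le 3$, then $M(2^r3^s)=11$ if $s=1$, $M(2^r3^s)=9$ if $s=2$, and $M(2^r3^s)=7$ if $s\ge3$. If $r\ge 4$, then $M(2^r3^s)=9$ if $s=1$, $M(2^r3^s)=7$ if $s=2$, and $M(2^r3^s)=5$ if $s\ge 3$. Let $p\ge 5$ be a prime and $r,s$ positive integers. Then $M(2^rp^s)=9$ if $s=1$ and either $p=2^r+1$ or $p=2^r-1$; $M(2^rp^s)=7$ if $s\ge 2$ and either $p=2^r+1$ or $p=2^r-1$; $M(2^rp^s)=7$ if $s=1$ and either $p$ is a Fermat prime with $p\ne 2^r+1$, or $p$ is a Mersenne prime with $p\neq 2^r-1$; and $M(2^rp^s)=5$ in all other cases.
   Context: A pair $(a,b)\in\mathbb{Z}^2$ is multiplicatively dependent if $ab\neq 0$ and there is $(k_1,k_2)\in\mathbb{Z}^2\setminus\{(0,0)\}$ with $a^{k_1}b^{k_2}=1$. For $d\in\mathbb{Z}$, $\mathcal{M}(d)$ is the set of multiplicatively dependent pairs $(a,b)\in\mathbb{Z}^2$ with $ab\ne0$ and $b-a=d$, and $M(d)=|\mathcal{M}(d)|$. A Fermat prime is a prime of the form $2^m+1$ with $m$ a positive integer; a Mersenne prime is a prime of the form $2^m-1$ with $m$ a positive integer. *)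

theory Defs
  imports Complex_Main "HOL-Computational_Algebra.Primes"
begin

definition mult_dependent :: "int \<times> int \<Rightarrow> bool" where
  "mult_dependent = (\<lambda>(a, b). a * b \<noteq> 0 \<and>
     (\<exists>k1 k2 :: int. (k1, k2) \<noteq> (0, 0) \<and> (of_int a :: rat) powi k1 * of_int b powi k2 = 1))"

definition M_set :: "int \<Rightarrow> (int \<times> int) set" where
  "M_set d = {(a, b). mult_dependent (a, b) \<and> a * b \<noteq> 0 \<and> b - a = d}"

(* card is 0 on infinite sets, so any claim M d = n with n > 0 includes finiteness of M_set d. *)
definition M :: "int \<Rightarrow> nat" where
  "M d = card (M_set d)"

definition fermat_prime :: "nat \<Rightarrow> bool" where
  "fermat_prime p \<longleftrightarrow> prime p \<and> (\<exists>m::nat. m > 0 \<and> p = 2 ^ m + 1)"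

definition mersenne_prime :: "nat \<Rightarrow> bool" where
  "mersenne_prime p \<longleftrightarrow> prime p \<and> (\<exists>m::nat. m > 0 \<and> p = 2 ^ m - 1)"

end

theory Submission
  imports Defs
begin

text \<open>
  Apart from the five pairs with \<open>a = \<plusminus>1\<close>, \<open>b = \<plusminus>1\<close> or \<open>a = -b\<close>, write the absolute values
  of \<open>a\<close> and \<open>b\<close> as \<open>u < v\<close>. Dependence \<open>u ^ m = v ^ n\<close> forces \<open>v = u * w\<close> where \<open>w ^ n\<close> is a power
  of \<open>u\<close>. Hence \<open>d = u * (w \<plusminus> 1)\<close> is a coprime factorisation of \<open>2 ^ r * p ^ s\<close>, so
  \<open>u\<close> is one of \<open>2 ^ r\<close>, \<open>p ^ s\<close>, and \<open>w\<close> is a power of the same prime. What remains are the equations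
  \<open>2 ^ k \<plusminus> 1 = p ^ s\<close> and \<open>p ^ k \<plusminus> 1 = 2 ^ r\<close>, each solution of which gives the two pairs
  \<open>(a, b)\<close> and \<open>(-b, -a)\<close>. These equations are elementary: for odd exponents \<open>(p ^ s \<plusminus> 1) / (p \<plusminus> 1)\<close> is odd,
  and for even ones one reduces modulo 4 or factors a difference of squares.
\<close>

section \<open>Powers of two next to powers of an odd number\<close>

text \<open>The cofactor is the geometric sum \<open>1 + p + ... + p ^ (s - 1)\<close>, an odd
  number of odd terms. Raising the exponent by two multiplies it by \<open>p\<^sup>2\<close> and
  adds the even number \<open>p + 1\<close>. Over the integers the result also applies to
  \<open>-p\<close>, which handles \<open>p ^ s + 1\<close>.\<close>

lemma odd_power_minus_one_factor:
  fixes p :: int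
  assumes "odd p" "odd s"
  shows "\<exists>m. odd m \<and> p ^ s - 1 = (p - 1) * m"
proof -
  obtain t where t: "s = 2 * t + 1" using assms(2) by (elim oddE)
  have "\<exists>m. odd m \<and> p ^ (2 * t + 1) - 1 = (p - 1) * m"
  proof (induction t)
    case 0
    show ?case by (intro exI[of _ 1]) simp
  next
    case (Suc t)
    then obtain m where m: "odd m" "p ^ (2 * t + 1) - 1 = (p - 1) * m" by blast
    have "p ^ (2 * Suc t + 1) - 1 = p\<^sup>2 * (p ^ (2 * t + 1) - 1) + (p\<^sup>2 - 1)"
      by (simp add: algebra_simps power2_eq_square)
    also have "\<dots> = (p - 1) * (p\<^sup>2 * m + p + 1)"
      unfolding m(2) by (simp add: algebra_simps power2_eq_square)
    finally show ?case using m(1) assms(1)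
      by (intro exI[of _ "p\<^sup>2 * m + p + 1"]) simp
  qed
  then show ?thesis using t by simp
qed

lemma odd_dvd_power_two_abs:
  fixes m :: int
  assumes "odd m" "m dvd 2 ^ k"
  shows "\<bar>m\<bar> = 1"
proof -
  have "coprime m (2 ^ k)" using assms(1) by simp
  then have "is_unit m" using assms(2) by (meson coprime_common_divisor dvd_refl)
  then show ?thesis by simp
qed

lemma power_eq_self_imp_one:
  fixes p :: nat
  assumes "p ^ s = p" "p \<ge> 2"
  shows "s = 1"
  using assms power_inject_exp[of p s 1] by simp

text \<open>For odd \<open>s\<close> the cofactor of \<open>p + 1\<close> in
  \<open>p ^ s + 1\<close> is odd, positive and divides a power of two, so it is 1 and
  \<open>p ^ s = p\<close>. For even \<open>s\<close> the right side is an odd square plus one,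
  hence 2 modulo 4, yet it is at least 4.\<close>

lemma power_two_eq_power_plus_one:
  fixes p :: nat
  assumes "odd p" "p \<ge> 3" "s > 0" and eq: "2 ^ k = p ^ s + 1"
  shows "s = 1"
proof (cases "odd s")
  case True
  \<comment> \<open>As \<open>s\<close> is odd, \<open>(-p) ^ s - 1\<close> is the negative of
    \<open>p ^ s + 1\<close>, and the factor \<open>-p - 1\<close> is the negative of
    \<open>p + 1\<close>.\<close>
  have "odd (- int p)" using assms(1) by simp
  from odd_power_minus_one_factor[OF this True] obtain m
    where m: "odd m" "(- int p) ^ s - 1 = (- int p - 1) * m" by blast
  have e: "(2::int) ^ k = int p ^ s + 1" using arg_cong[OF eq, of int] by simp
  have e2: "int p ^ s + 1 = (int p + 1) * m"
    using m(2) True by (simp add: algebra_simps)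
  then have "m dvd 2 ^ k" using e by simp
  then have "\<bar>m\<bar> = 1" using m(1) odd_dvd_power_two_abs by blast
  moreover have "m > 0"
  proof -
    have "(int p + 1) * m > 0" using e2 e by (metis zero_less_power zero_less_numeral)
    then show ?thesis by (simp add: zero_less_mult_iff)
  qed
  ultimately have "m = 1" by simp
  then have "int p ^ s = int p" using e2 by simp
  then have "p ^ s = p" by (metis of_nat_eq_iff of_nat_power)
  then show ?thesis using assms(2) power_eq_self_imp_one by simp
next
  case False
  then obtain t where t: "s = 2 * t" by (auto elim: evenE)
  obtain q where q: "p ^ t = 2 * q + 1" using assms(1) by (metis even_power oddE)
  have "p ^ s = (p ^ t)\<^sup>2" unfolding t by (simp add: power_even_eq)
  also have "\<dots> = 4 * (q * q + q) + 1" unfolding q by (simp add: algebra_simps power2_eq_square)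
  finally have "2 ^ k = 4 * (q * q + q) + 2" using eq by simp
  moreover have "k \<ge> 2"
  proof (rule ccontr)
    assume "\<not> k \<ge> 2"
    then have "k = 0 \<or> k = 1" by auto
    then have "(2::nat) ^ k \<le> 2" by auto
    moreover have "p ^ s \<ge> p" using assms(2,3) by (simp add: self_le_power)
    ultimately show False using eq assms(2) by linarith
  qed
  then obtain j where "k = Suc (Suc j)" by (metis Suc_le_D numeral_2_eq_2 Suc_le_mono)
  ultimately have "4 * 2 ^ j = 4 * (q * q + q) + 2" by simp
  \<comment> \<open>The two sides differ modulo 4, so an even \<open>s\<close> is
    impossible.\<close>
  then show ?thesis by presburger
qed

text \<open>Odd \<open>s\<close> is settled by the odd cofactor of \<open>p - 1\<close>. For
  \<open>s = 2 * t\<close> and \<open>x = p ^ t\<close>, both \<open>x - 1\<close> and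
  \<open>x + 1\<close> divide \<open>2 ^ k\<close>, and the only suitable powers of two at distance
  2 are 2 and 4. This leaves just \<open>9 = 8 + 1\<close>.\<close>

lemma power_eq_power_two_plus_one:
  fixes p :: nat
  assumes "odd p" "p \<ge> 3" "s > 0" and eq: "p ^ s = 2 ^ k + 1"
  shows "s = 1 \<or> p = 3 \<and> s = 2 \<and> k = 3"
proof (cases "odd s")
  case True
  have "odd (int p)" using assms(1) by simp
  from odd_power_minus_one_factor[OF this True] obtain m
    where m: "odd m" "int p ^ s - 1 = (int p - 1) * m" by blast
  have e: "int p ^ s - 1 = 2 ^ k" using arg_cong[OF eq, of int] by simp
  then have "m dvd 2 ^ k" using m(2) by (metis dvd_triv_right)
  then have "\<bar>m\<bar> = 1" using m(1) odd_dvd_power_two_abs by blast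
  moreover have "m > 0"
  proof -
    have "(int p - 1) * m > 0" using m(2) e by (metis zero_less_power zero_less_numeral)
    then show ?thesis using assms(2) by (simp add: zero_less_mult_iff)
  qed
  ultimately have "m = 1" by simp
  then have "int p ^ s = int p" using m(2) by simp
  then have "p ^ s = p" by (metis of_nat_eq_iff of_nat_power)
  then show ?thesis using assms(2) power_eq_self_imp_one by simp
next
  case False
  then obtain t where t: "s = 2 * t" by (auto elim: evenE)
  define x where "x = p ^ t"
  have "t > 0" using t assms(3) by simp
  then have x3: "x \<ge> 3" using assms(2) self_le_power[of p t] unfolding x_def by simp
  have "p ^ s = x * x" unfolding x_def t by (simp add: mult_2 power_add)
  then have "(x - 1) * (x + 1) = 2 ^ k" using eq by (simp add: algebra_simps)
  then have "x - 1 dvd 2 ^ k" "x + 1 dvd 2 ^ k" by (metis dvd_triv_left, metis dvd_triv_right)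
  then obtain i j where i: "x - 1 = 2 ^ i" and j: "x + 1 = 2 ^ j"
    using divides_primepow_nat[OF two_is_prime_nat] by blast
  have ij: "2 ^ j = 2 ^ i + (2::nat)" using i j x3 by linarith
  \<comment> \<open>Exponent 0 would give \<open>x = 2\<close>; an exponent of at least 2 would make
    4 divide two numbers that differ by 2.\<close>
  have "i = 1"
  proof (rule ccontr)
    assume "i \<noteq> 1"
    have "i \<noteq> 0" using i x3 by (intro notI) simp
    with \<open>i \<noteq> 1\<close> obtain i' where i': "i = Suc (Suc i')" by (metis One_nat_def not0_implies_Suc)
    have "(2::nat) ^ j > 2 ^ i" using ij by simp
    then have "j > i" by (simp add: power_strict_increasing_iff)
    then obtain j' where "j = Suc (Suc j')" using i' by (metis Suc_lessE)
    then have "4 * 2 ^ j' = 4 * 2 ^ i' + (2::nat)" using ij i' by simp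
    then show False by presburger
  qed
  then have x: "x = 3" using i x3 by simp
  have "p \<le> p ^ t" using \<open>t > 0\<close> assms(2) by (simp add: self_le_power)
  then have "p = 3" using x assms(2) unfolding x_def by simp
  then have "t = 1" using x power_eq_self_imp_one[of p t] unfolding x_def by simp
  have "s = 2" using t \<open>t = 1\<close> by simp
  then have "(2::nat) ^ k = 2 ^ 3" using eq \<open>p = 3\<close> by simp
  then have "k = 3" by (metis power_inject_exp one_less_numeral_iff semiring_norm(76))
  then show ?thesis using \<open>p = 3\<close> \<open>s = 2\<close> by simp
qed

section \<open>Dependence of absolute values\<close>

text \<open>Absolute values remove the signs of \<open>a\<close> and \<open>b\<close>. Exponents of
  opposite sign put the two powers on opposite sides; exponents of equal sign make both powers 1,
  hence equal to each other.\<close>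

lemma mult_dependent_iff:
  assumes "a \<noteq> 0" "b \<noteq> 0"
  shows "mult_dependent (a, b) \<longleftrightarrow> (\<exists>m n. (m, n) \<noteq> (0, 0) \<and> nat \<bar>a\<bar> ^ m = nat \<bar>b\<bar> ^ n)"
proof
  assume "mult_dependent (a, b)"
  then obtain k1 k2 :: int where k: "(k1, k2) \<noteq> (0, 0)"
    and eq: "(of_int a :: rat) powi k1 * of_int b powi k2 = 1"
    unfolding mult_dependent_def by auto
  define u v where "u = nat \<bar>a\<bar>" and "v = nat \<bar>b\<bar>"
  have uv: "u > 0" "v > 0" using assms unfolding u_def v_def by auto
  have au: "of_nat u = \<bar>of_int a :: rat\<bar>" and bv: "of_nat v = \<bar>of_int b :: rat\<bar>"
    unfolding u_def v_def by (simp_all add: of_nat_nat)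
  have "\<bar>(of_int a :: rat) powi k1 * of_int b powi k2\<bar> = 1" using eq by simp
  then have eq': "(of_nat u :: rat) powi k1 * of_nat v powi k2 = 1"
    unfolding au bv by (simp add: abs_mult power_int_abs)
  have same_sign: "\<exists>m n. (m, n) \<noteq> (0, 0) \<and> u ^ m = v ^ n"
    if "(i, j) \<noteq> (0, 0)" "(of_nat u :: rat) ^ i * of_nat v ^ j = 1" for i j
  proof -
    have "of_nat (u ^ i * v ^ j) = (of_nat 1 :: rat)" using that(2) by simp
    then have "u ^ i * v ^ j = 1" unfolding of_nat_eq_iff .
    then have "u ^ i = 1" "v ^ j = 1" by (auto simp only: nat_mult_eq_1_iff)
    then have "u ^ i = v ^ j" by (rule trans[OF _ sym])
    then show ?thesis using that(1) by blast
  qed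
  have opp_sign: "u ^ i = v ^ j" if "(of_nat u :: rat) ^ i = of_nat v ^ j" for i j
    using that by (metis of_nat_eq_iff of_nat_power)
  have k': "(nat \<bar>k1\<bar>, nat \<bar>k2\<bar>) \<noteq> (0, 0)" using k by auto
  have "(\<exists>m n. (m, n) \<noteq> (0, 0) \<and> u ^ m = v ^ n)"
  proof (cases "k1 \<ge> 0"; cases "k2 \<ge> 0")
    assume "k1 \<ge> 0" "k2 \<ge> 0"
    then show ?thesis using same_sign[OF k'] eq' by (simp add: power_int_def)
  next
    assume "k1 \<ge> 0" "\<not> k2 \<ge> 0"
    then have "(of_nat u :: rat) ^ nat \<bar>k1\<bar> = of_nat v ^ nat \<bar>k2\<bar>"
      using eq' uv by (simp add: power_int_def field_simps)
    then show ?thesis using opp_sign k' by blast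
  next
    assume "\<not> k1 \<ge> 0" "k2 \<ge> 0"
    then have "(of_nat u :: rat) ^ nat \<bar>k1\<bar> = of_nat v ^ nat \<bar>k2\<bar>"
      using eq' uv by (simp add: power_int_def field_simps)
    then show ?thesis using opp_sign k' by blast
  next
    assume "\<not> k1 \<ge> 0" "\<not> k2 \<ge> 0"
    then have "(of_nat u :: rat) ^ nat \<bar>k1\<bar> * of_nat v ^ nat \<bar>k2\<bar> = 1"
      using eq' uv by (simp add: power_int_def field_simps)
    then show ?thesis using same_sign[OF k'] by blast
  qed
  then show "\<exists>m n. (m, n) \<noteq> (0, 0) \<and> nat \<bar>a\<bar> ^ m = nat \<bar>b\<bar> ^ n"
    unfolding u_def v_def .
next
  assume "\<exists>m n. (m, n) \<noteq> (0, 0) \<and> nat \<bar>a\<bar> ^ m = nat \<bar>b\<bar> ^ n"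
  then obtain m n where mn: "(m, n) \<noteq> (0, 0)" and eq: "nat \<bar>a\<bar> ^ m = nat \<bar>b\<bar> ^ n" by blast
  have "\<bar>a\<bar> ^ m = \<bar>b\<bar> ^ n" using arg_cong[OF eq, of int] by simp
  \<comment> \<open>Doubling both exponents makes the signs of \<open>a\<close> and \<open>b\<close>
    irrelevant.\<close>
  then have "(\<bar>a\<bar> ^ m)\<^sup>2 = (\<bar>b\<bar> ^ n)\<^sup>2" by simp
  then have "a ^ (2 * m) = b ^ (2 * n)" by (simp add: power_even_eq power_abs [symmetric])
  then have "(of_int a :: rat) ^ (2 * m) = of_int b ^ (2 * n)" by (metis of_int_power)
  then have "(of_int a :: rat) powi int (2 * m) * of_int b powi (- int (2 * n)) = 1"
    using assms by (simp only: power_int_minus power_int_of_nat) simp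
  moreover have "(int (2 * m), - int (2 * n)) \<noteq> (0, 0)" using mn by auto
  ultimately have "\<exists>k1 k2 :: int. (k1, k2) \<noteq> (0, 0) \<and> (of_int a :: rat) powi k1 * of_int b powi k2 = 1"
    by blast
  then show "mult_dependent (a, b)" using assms by (simp add: mult_dependent_def)
qed

text \<open>Multiplicative dependence of positive naturals, with one power on each side so that
  natural exponents suffice.\<close>

definition power_related :: "nat \<Rightarrow> nat \<Rightarrow> bool" where
  "power_related u v \<longleftrightarrow> (\<exists>m n. (m, n) \<noteq> (0, 0) \<and> u ^ m = v ^ n)"

lemma power_related_sym: "power_related u v \<longleftrightarrow> power_related v u"
proof -
  have "power_related v u" if uv: "power_related u v" for u v
  proof -
    obtain m n where "(m, n) \<noteq> (0, 0)" "u ^ m = v ^ n"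
      using uv unfolding power_related_def by blast
    then have "(n, m) \<noteq> (0, 0)" "v ^ n = u ^ m" by auto
    then show ?thesis unfolding power_related_def by blast
  qed
  then show ?thesis by blast
qed

lemma power_related_powers:
  assumes "x > 0"
  shows "power_related (c ^ x) (c ^ y)"
  unfolding power_related_def using assms
  by (intro exI[of _ y] exI[of _ x]) (simp add: mult.commute flip: power_mult)

lemma mult_dependent_iff_power_related:
  "mult_dependent (a, b) \<longleftrightarrow> a \<noteq> 0 \<and> b \<noteq> 0 \<and> power_related (nat \<bar>a\<bar>) (nat \<bar>b\<bar>)"
  using mult_dependent_iff[of a b] unfolding power_related_def
  by (cases "a = 0 \<or> b = 0") (auto simp: mult_dependent_def)

text \<open>From \<open>u ^ m = v ^ n\<close> and \<open>u < v\<close> follows \<open>n < m\<close>,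
  so \<open>u ^ n\<close> divides \<open>v ^ n\<close> and \<open>u\<close> divides
  \<open>v\<close>. Cancelling \<open>u ^ n\<close> leaves \<open>w ^ n = u ^ (m - n)\<close>; this
  difference is the exponent \<open>m\<close> handed out. It makes \<open>u\<close> and
  \<open>w\<close> share their prime divisors.\<close>

lemma power_related_cofactor:
  assumes "power_related u v" "2 \<le> u" "u < v"
  obtains w m n where "v = u * w" "w \<ge> 2" "n > 0" "w ^ n = u ^ m"
proof -
  obtain m n where mn: "(m, n) \<noteq> (0, 0)" and eq: "u ^ m = v ^ n"
    using assms(1) unfolding power_related_def by blast
  have n: "n > 0"
  proof (rule ccontr)
    assume "\<not> n > 0"
    then have "n = 0" by simp
    then show False using eq mn assms(2) by simp
  qed
  have "u ^ n < v ^ n" using assms n by (simp add: power_strict_mono)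
  then have "u ^ n < u ^ m" using eq by simp
  then have "n < m" using assms(2) by (simp add: power_strict_increasing_iff)
  then have m: "u ^ m = u ^ n * u ^ (m - n)" by (simp flip: power_add)
  then have "u ^ n dvd v ^ n" using eq by (metis dvd_triv_left)
  then have "u dvd v" using n by simp
  then obtain w where w: "v = u * w" by blast
  have "w \<ge> 2"
  proof (rule ccontr)
    assume "\<not> w \<ge> 2"
    then have "w = 0 \<or> w = 1" by auto
    then show False using assms(3) w by auto
  qed
  have "u ^ n * w ^ n = u ^ n * u ^ (m - n)" using eq m w by (metis power_mult_distrib)
  then have "w ^ n = u ^ (m - n)" using assms(2) by simp
  then show thesis using that w \<open>w \<ge> 2\<close> n by blast
qed

section \<open>Counting pairs by absolute values\<close>

text \<open>The absolute values, in increasing order, of pairs with equal signs;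
  \<open>sum_pairs\<close> is the analogue for opposite signs. The bounds \<open>2 \<le> u\<close>
  and \<open>u < v\<close> leave out the pairs containing a unit and those with
  \<open>a = -b\<close>.\<close>

definition diff_pairs :: "nat \<Rightarrow> (nat \<times> nat) set" where
  "diff_pairs d = {(u, v). 2 \<le> u \<and> u < v \<and> power_related u v \<and> v = u + d}"

definition sum_pairs :: "nat \<Rightarrow> (nat \<times> nat) set" where
  "sum_pairs d = {(u, v). 2 \<le> u \<and> u < v \<and> power_related u v \<and> u + v = d}"

text \<open>Evenness of \<open>d\<close> makes \<open>a = -b\<close> solvable, by
  \<open>(-e, e)\<close>. The map from \<open>(a, b)\<close> to \<open>(-b, -a)\<close> preserves
  the difference, so each pair of absolute values contributes twice.\<close>

lemma M_set_decomposition: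
  assumes "e \<ge> 2"
  defines "d \<equiv> 2 * int e"
  shows "M_set d = {(1, d + 1), (-1, d - 1), (1 - d, 1), (-1 - d, -1), (- int e, int e)} \<union>
    (\<lambda>(u, v). (int u, int v)) ` diff_pairs (2 * e) \<union>
    (\<lambda>(u, v). (- int v, - int u)) ` diff_pairs (2 * e) \<union>
    (\<lambda>(u, v). (- int u, int v)) ` sum_pairs (2 * e) \<union>
    (\<lambda>(u, v). (- int v, int u)) ` sum_pairs (2 * e)" (is "_ = ?R")
proof -
  have sub1: "(a, b) \<in> ?R" if "(a, b) \<in> M_set d" for a b
  proof -
    define u v where "u = nat \<bar>a\<bar>" and "v = nat \<bar>b\<bar>"
    have nz: "a \<noteq> 0" "b \<noteq> 0" and rel: "power_related u v" and ba: "b = a + d"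
      using that unfolding M_set_def u_def v_def by (auto simp: mult_dependent_iff_power_related)
    have rel': "power_related v u" using rel by (simp add: power_related_sym)
    \<comment> \<open>Since \<open>d > 0\<close> gives \<open>a < b\<close>, beyond the five special
      shapes both numbers are positive, both are negative, or \<open>a < 0 < b\<close> with one
      absolute value strictly larger.\<close>
    consider "a = 1" | "a = -1" | "b = 1" | "b = -1" | "a = - b" |
      "a \<ge> 2" | "b \<le> -2" | "a \<le> -2" "b \<ge> 2" "-a < b" | "a \<le> -2" "b \<ge> 2" "b < -a"
      using nz ba assms(1) unfolding d_def by linarith
    then show ?thesis
    proof cases
      case 6
      then have "(u, v) \<in> diff_pairs (2 * e)" "(a, b) = (int u, int v)"
        using rel ba assms(1) unfolding diff_pairs_def u_def v_def d_def by auto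
      then show ?thesis by force
    next
      case 7
      then have "(v, u) \<in> diff_pairs (2 * e)" "(a, b) = (- int u, - int v)"
        using rel' ba assms(1) unfolding diff_pairs_def u_def v_def d_def by auto
      then show ?thesis by force
    next
      case 8
      then have "(u, v) \<in> sum_pairs (2 * e)" "(a, b) = (- int u, int v)"
        using rel ba assms(1) unfolding sum_pairs_def u_def v_def d_def by auto
      then show ?thesis by force
    next
      case 9
      then have "(v, u) \<in> sum_pairs (2 * e)" "(a, b) = (- int u, int v)"
        using rel' ba assms(1) unfolding sum_pairs_def u_def v_def d_def by auto
      then show ?thesis by force
    qed (use ba in \<open>auto simp: d_def\<close>)
  qed
  have sub2: "(a, b) \<in> M_set d" if "(a, b) \<in> ?R" for a b
  proof -
    have one: "power_related 1 u" "power_related u 1" for u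
      unfolding power_related_def by (rule exI[of _ 1], rule exI[of _ 0], simp,
          rule exI[of _ 0], rule exI[of _ 1], simp)
    have same: "power_related u u" for u
      unfolding power_related_def by (rule exI[of _ 1], rule exI[of _ 1]) simp
    consider "(a, b) \<in> {(1, d + 1), (-1, d - 1), (1 - d, 1), (-1 - d, -1), (- int e, int e)}"
      | u v where "(u, v) \<in> diff_pairs (2 * e)" "(a, b) = (int u, int v) \<or> (a, b) = (- int v, - int u)"
      | u v where "(u, v) \<in> sum_pairs (2 * e)" "(a, b) = (- int u, int v) \<or> (a, b) = (- int v, int u)"
      using \<open>(a, b) \<in> ?R\<close> by auto
    then show ?thesis
    proof cases
      case 1
      then show ?thesis using assms(1) one same
        by (auto simp: M_set_def mult_dependent_iff_power_related d_def)
    next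
      case 2
      then have "power_related u v" "power_related v u"
        unfolding diff_pairs_def using power_related_sym[of u v] by auto
      moreover have "nat \<bar>a\<bar> = u \<and> nat \<bar>b\<bar> = v \<or> nat \<bar>a\<bar> = v \<and> nat \<bar>b\<bar> = u" "a \<noteq> 0" "b \<noteq> 0" "b - a = d"
        using 2 by (auto simp: d_def diff_pairs_def)
      ultimately show ?thesis by (auto simp: M_set_def mult_dependent_iff_power_related)
    next
      case 3
      then have "power_related u v" "power_related v u"
        unfolding sum_pairs_def using power_related_sym[of u v] by auto
      moreover have "nat \<bar>a\<bar> = u \<and> nat \<bar>b\<bar> = v \<or> nat \<bar>a\<bar> = v \<and> nat \<bar>b\<bar> = u" "a \<noteq> 0" "b \<noteq> 0" "b - a = d"
        using 3 by (auto simp: d_def sum_pairs_def)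
      ultimately show ?thesis by (auto simp: M_set_def mult_dependent_iff_power_related)
    qed
  qed
  show ?thesis by (rule equalityI; rule subrelI; erule sub1 sub2)
qed

text \<open>The families of the decomposition are disjoint, so their sizes add up;
  \<open>e \<ge> 2\<close> keeps the five special pairs distinct, while some coincide for
  \<open>e = 1\<close>.\<close>

lemma M_eq_card_pairs:
  assumes "e \<ge> 2" "finite (diff_pairs (2 * e))" "finite (sum_pairs (2 * e))"
  shows "M (2 * int e) = 5 + 2 * card (diff_pairs (2 * e)) + 2 * card (sum_pairs (2 * e))"
proof -
  let ?D = "diff_pairs (2 * e)" and ?S = "sum_pairs (2 * e)" and ?d = "2 * int e"
  let ?B = "{(1, ?d + 1), (-1, ?d - 1), (1 - ?d, 1), (-1 - ?d, -1), (- int e, int e)}"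
  let ?f1 = "\<lambda>(u, v). (int u, int v)" and ?f2 = "\<lambda>(u, v). (- int v, - int u)"
    and ?f3 = "\<lambda>(u, v). (- int u, int v)" and ?f4 = "\<lambda>(u, v). (- int v, int u)"
  have B: "card ?B = 5" using assms(1) by simp
  have c1: "card (?f1 ` ?D) = card ?D" "card (?f2 ` ?D) = card ?D"
    "card (?f3 ` ?S) = card ?S" "card (?f4 ` ?S) = card ?S"
    by (intro card_image; auto simp: inj_on_def)+
  \<comment> \<open>A label that reads off from a pair which of the five families contains it; each
    family is then disjoint from the union of those with smaller labels.\<close>
  define g :: "int \<times> int \<Rightarrow> nat" where "g = (\<lambda>(a, b).
    if \<bar>a\<bar> = 1 \<or> \<bar>b\<bar> = 1 \<or> a = - b then 0 else if a \<ge> 2 then 1 else if b \<le> -2 then 2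
    else if - a < b then 3 else 4)"
  have g: "\<forall>x\<in>?B. g x = 0" "\<forall>x\<in>?f1 ` ?D. g x = 1" "\<forall>x\<in>?f2 ` ?D. g x = 2"
    "\<forall>x\<in>?f3 ` ?S. g x = 3" "\<forall>x\<in>?f4 ` ?S. g x = 4"
    by (auto simp: g_def diff_pairs_def sum_pairs_def)
  have disj: "A \<inter> C = {}" if "\<forall>x\<in>A. g x < n" "\<forall>x\<in>C. g x = n" for A C n
    using that by fastforce
  have d1: "?B \<inter> ?f1 ` ?D = {}"
    by (rule disj[of _ 1]; use g in \<open>simp add: ball_Un del: insert_iff\<close>)
  have d2: "(?B \<union> ?f1 ` ?D) \<inter> ?f2 ` ?D = {}"
    by (rule disj[of _ 2]; use g in \<open>simp add: ball_Un del: insert_iff\<close>)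
  have d3: "(?B \<union> ?f1 ` ?D \<union> ?f2 ` ?D) \<inter> ?f3 ` ?S = {}"
    by (rule disj[of _ 3]; use g in \<open>simp add: ball_Un del: insert_iff\<close>)
  have d4: "(?B \<union> ?f1 ` ?D \<union> ?f2 ` ?D \<union> ?f3 ` ?S) \<inter> ?f4 ` ?S = {}"
    by (rule disj[of _ 4]; use g in \<open>simp add: ball_Un del: insert_iff\<close>)
  have f: "finite ?B" by simp
  show ?thesis unfolding M_def M_set_decomposition[OF assms(1)]
    using B c1 f assms(2,3)
    by (simp only: card_Un_disjoint[OF _ _ d1] card_Un_disjoint[OF _ _ d2] card_Un_disjoint[OF _ _ d3]
        card_Un_disjoint[OF _ _ d4] finite_UnI finite_imageI)
qed

section \<open>Differences of the form \<open>2 ^ r * p ^ s\<close>\<close>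

lemma odd_prime_ge_3:
  fixes p :: nat
  assumes "prime p" "odd p"
  shows "p \<ge> 3"
proof -
  have "p \<noteq> 2" using assms(2) by auto
  then show ?thesis using prime_ge_2_nat[OF assms(1)] by simp
qed

text \<open>Every prime divisor of \<open>u\<close> divides \<open>w\<close> and so misses the
  neighbour \<open>f\<close> of \<open>w\<close>. Thus \<open>u\<close> and \<open>f\<close> are
  coprime, and each of \<open>2 ^ r\<close> and \<open>p ^ s\<close> lies wholly in one of them. The
  two options for \<open>f\<close> serve sums and differences.\<close>

lemma coprime_factorisation_cases:
  fixes p u f w :: nat
  assumes p: "prime p" "odd p" and "2 \<le> u" "w \<ge> 2" "n > 0" "w ^ n = u ^ m"
    and uf: "u * f = 2 ^ r * p ^ s" and fw: "f = w + 1 \<or> w = f + 1"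
  shows "(\<exists>k>0. u = 2 ^ r \<and> w = 2 ^ k \<and> f = p ^ s) \<or> (\<exists>k>0. u = p ^ s \<and> w = p ^ k \<and> f = 2 ^ r)"
proof -
  have dvd_w: "q dvd w" if "q dvd u" "prime q" for q
  proof -
    have "m > 0"
    proof (rule ccontr)
      assume "\<not> m > 0"
      then have "w ^ n = 1" using assms(6) by simp
      then show False using assms(4,5) by simp
    qed
    then have "q dvd w ^ n" using that(1) unfolding assms(6) by (simp add: dvd_power_le dvd_trans)
    then show ?thesis using that(2) prime_dvd_power by blast
  qed
  have not_both: "\<not> q dvd f" if "q dvd w" "prime q" for q
    using fw that by (metis dvd_add_right_iff not_prime_unit)
  have cop2p: "coprime 2 p" using p(2) by simp
  have w_power: "\<exists>k>0. w = q ^ k" if q: "u = q ^ t" "prime q" for q t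
  proof -
    have "w dvd q ^ (t * m)" using assms(5,6) q(1) by (metis dvd_power power_mult)
    then obtain k where "w = q ^ k" using divides_primepow_nat[OF q(2)] by blast
    then show ?thesis using assms(4) by (cases k) auto
  qed
  have power_dvd: "q ^ t dvd u" if "prime q" "q dvd u" "q ^ t dvd u * f" for q t
  proof -
    have "coprime q f" using prime_imp_coprime that not_both dvd_w by blast
    then have "coprime (q ^ t) f" by simp
    then show ?thesis using that(3) by (simp add: coprime_dvd_mult_left_iff)
  qed
  have power_dvd': "q ^ t dvd f" if "prime q" "\<not> q dvd u" "q ^ t dvd u * f" for q t
  proof -
    have "coprime q u" using prime_imp_coprime that by blast
    then have "coprime (q ^ t) u" by simp
    then show ?thesis using that(3) by (simp add: coprime_dvd_mult_right_iff)
  qed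
  \<comment> \<open>The product of the two cofactors is 1, as \<open>u * f\<close> is
    positive.\<close>
  have split: "u = x \<and> f = y" if xy: "x dvd u" "y dvd f" "x * y = u * f" for x y
  proof -
    obtain a b where ab: "u = x * a" "f = y * b" using xy by blast
    have "u * f > 0" using uf p(1) by (simp add: prime_gt_0_nat)
    then have pos: "x * y > 0" unfolding xy(3) .
    have "x * y = x * a * (y * b)" using xy(3) unfolding ab .
    then have "x * y * (a * b) = x * y * 1" by (simp add: ac_simps)
    then have "a * b = 1" using pos by (metis mult_cancel1 less_irrefl)
    then show ?thesis using ab by simp
  qed
  have d: "2 ^ r dvd u * f" "p ^ s dvd u * f" using uf by simp_all
  show ?thesis
  proof (cases "2 dvd u"; cases "p dvd u")
    \<comment> \<open>If \<open>u\<close> absorbs everything, then \<open>f = 1\<close> and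
      \<open>w = 2\<close>, which the odd prime \<open>p\<close> cannot divide.\<close>
    assume "2 dvd u" "p dvd u"
    then have "2 ^ r dvd u" "p ^ s dvd u" using power_dvd d p(1) two_is_prime_nat by blast+
    then have "2 ^ r * p ^ s dvd u" using cop2p by (simp add: divides_mult)
    then have "f = 1" using split[of "2 ^ r * p ^ s" 1] uf by simp
    moreover have "p dvd w" using dvd_w \<open>p dvd u\<close> p(1) by blast
    moreover have "p > 2" using odd_prime_ge_3[OF p] by simp
    ultimately show ?thesis using fw assms(4) by (auto dest: dvd_imp_le)
  next
    assume "2 dvd u" "\<not> p dvd u"
    then have "2 ^ r dvd u" "p ^ s dvd f" using power_dvd power_dvd' d p(1) two_is_prime_nat by blast+
    then have "u = 2 ^ r \<and> f = p ^ s" using uf[symmetric] by (rule split)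
    then show ?thesis using w_power[of 2 r] by auto
  next
    assume "\<not> 2 dvd u" "p dvd u"
    then have "p ^ s dvd u" "2 ^ r dvd f" using power_dvd power_dvd' d p(1) two_is_prime_nat by blast+
    moreover have "p ^ s * 2 ^ r = u * f" unfolding uf by (rule mult.commute)
    ultimately have "u = p ^ s \<and> f = 2 ^ r" by (rule split)
    then show ?thesis using w_power[of p s] p(1) by auto
  next
    assume n: "\<not> 2 dvd u" "\<not> p dvd u"
    obtain q where q: "prime q" "q dvd u" using assms(3) prime_factor_nat[of u] by auto
    then have "q dvd 2 ^ r * p ^ s" using uf by (metis dvd_mult2)
    then have "q dvd 2 \<or> q dvd p" using q(1) by (metis prime_dvd_mult_iff prime_dvd_power)
    then have "q = 2 \<or> q = p" using q(1) p(1) two_is_prime_nat primes_dvd_imp_eq by blast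
    then show ?thesis using q n by auto
  qed
qed

text \<open>With \<open>v = u * w\<close> the difference is \<open>u * (w - 1)\<close>, and the
  factorisation lemma applies with \<open>f = w - 1\<close>. Conversely, the listed entries are
  powers of one base.\<close>

lemma diff_pairs_prime_powers:
  fixes p :: nat
  assumes p: "prime p" "odd p" and rs: "r > 0" "s > 0"
  shows "diff_pairs (2 ^ r * p ^ s) =
    (\<lambda>k. (2 ^ r, 2 ^ r * 2 ^ k)) ` {k. k > 0 \<and> 2 ^ k = p ^ s + 1} \<union>
    (\<lambda>k. (p ^ s, p ^ s * p ^ k)) ` {k. k > 0 \<and> p ^ k = 2 ^ r + 1}" (is "_ = ?R")
proof -
  have p3: "p \<ge> 3" using odd_prime_ge_3 p by blast
  have sub1: "(u, v) \<in> ?R" if "(u, v) \<in> diff_pairs (2 ^ r * p ^ s)" for u v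
  proof -
    have uv: "2 \<le> u" "u < v" "power_related u v" "v = u + 2 ^ r * p ^ s"
      using that unfolding diff_pairs_def by auto
    obtain w m n where w: "v = u * w" "w \<ge> 2" "n > 0" "w ^ n = u ^ m"
      using power_related_cofactor[OF uv(3,1,2)] .
    have "u * (w - 1) = 2 ^ r * p ^ s" using uv(4) w(1) by (simp add: right_diff_distrib')
    \<comment> \<open>\<open>w \<ge> 2\<close> makes the truncated subtraction exact.\<close>
    moreover have "w = (w - 1) + 1" using w(2) by simp
    ultimately have "(\<exists>k>0. u = 2 ^ r \<and> w = 2 ^ k \<and> w - 1 = p ^ s) \<or>
      (\<exists>k>0. u = p ^ s \<and> w = p ^ k \<and> w - 1 = 2 ^ r)"
      using coprime_factorisation_cases[OF p uv(1) w(2-4)] by blast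
    then show ?thesis using w(1) \<open>w = (w - 1) + 1\<close> by fastforce
  qed
  have sub2: "(u, v) \<in> diff_pairs (2 ^ r * p ^ s)" if "(u, v) \<in> ?R" for u v
  proof -
    have ge2: "2 \<le> (2::nat) ^ r" "2 \<le> p ^ s"
      using self_le_power[of "2::nat" r] self_le_power[of p s] rs p3 by linarith+
    from that consider k where "k > 0" "2 ^ k = p ^ s + 1" "u = 2 ^ r" "v = 2 ^ r * 2 ^ k"
      | k where "k > 0" "p ^ k = 2 ^ r + 1" "u = p ^ s" "v = p ^ s * p ^ k" by auto
    then show ?thesis
    proof cases
      case 1
      have "power_related u v" unfolding 1(3,4) power_add[symmetric] by (rule power_related_powers[OF rs(1)])
      then show ?thesis using 1 ge2 p3 by (simp add: diff_pairs_def algebra_simps)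
    next
      case 2
      have "power_related u v" unfolding 2(3,4) power_add[symmetric] by (rule power_related_powers[OF rs(2)])
      then show ?thesis using 2 ge2 p3 by (simp add: diff_pairs_def algebra_simps)
    qed
  qed
  show ?thesis by (rule equalityI; rule subrelI; erule sub1 sub2)
qed

text \<open>The same argument with \<open>u + v = u * (w + 1)\<close>, hence
  \<open>f = w + 1\<close>.\<close>

lemma sum_pairs_prime_powers:
  fixes p :: nat
  assumes p: "prime p" "odd p" and rs: "r > 0" "s > 0"
  shows "sum_pairs (2 ^ r * p ^ s) =
    (\<lambda>k. (2 ^ r, 2 ^ r * 2 ^ k)) ` {k. k > 0 \<and> p ^ s = 2 ^ k + 1} \<union>
    (\<lambda>k. (p ^ s, p ^ s * p ^ k)) ` {k. k > 0 \<and> 2 ^ r = p ^ k + 1}" (is "_ = ?R")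
proof -
  have p3: "p \<ge> 3" using odd_prime_ge_3 p by blast
  have sub1: "(u, v) \<in> ?R" if "(u, v) \<in> sum_pairs (2 ^ r * p ^ s)" for u v
  proof -
    have uv: "2 \<le> u" "u < v" "power_related u v" "u + v = 2 ^ r * p ^ s"
      using that unfolding sum_pairs_def by auto
    obtain w m n where w: "v = u * w" "w \<ge> 2" "n > 0" "w ^ n = u ^ m"
      using power_related_cofactor[OF uv(3,1,2)] .
    have "u * (w + 1) = 2 ^ r * p ^ s" using uv(4) w(1) by simp
    then have "(\<exists>k>0. u = 2 ^ r \<and> w = 2 ^ k \<and> w + 1 = p ^ s) \<or>
      (\<exists>k>0. u = p ^ s \<and> w = p ^ k \<and> w + 1 = 2 ^ r)"
      using coprime_factorisation_cases[OF p uv(1) w(2-4)] by blast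
    then show ?thesis using w(1) by fastforce
  qed
  have sub2: "(u, v) \<in> sum_pairs (2 ^ r * p ^ s)" if "(u, v) \<in> ?R" for u v
  proof -
    have ge2: "2 \<le> (2::nat) ^ r" "2 \<le> p ^ s"
      using self_le_power[of "2::nat" r] self_le_power[of p s] rs p3 by linarith+
    from that consider k where "k > 0" "p ^ s = 2 ^ k + 1" "u = 2 ^ r" "v = 2 ^ r * 2 ^ k"
      | k where "k > 0" "2 ^ r = p ^ k + 1" "u = p ^ s" "v = p ^ s * p ^ k" by auto
    then show ?thesis
    proof cases
      case 1
      have "power_related u v" unfolding 1(3,4) power_add[symmetric] by (rule power_related_powers[OF rs(1)])
      moreover have "(2::nat) ^ k > 1" using 1(1) by (intro one_less_power) simp_all
      ultimately show ?thesis using 1 ge2 p3 by (simp add: sum_pairs_def algebra_simps)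
    next
      case 2
      have "power_related u v" unfolding 2(3,4) power_add[symmetric] by (rule power_related_powers[OF rs(2)])
      moreover have "p ^ k > 1" using 2(1) p3 by (intro one_less_power) simp_all
      ultimately show ?thesis using 2 ge2 p3 by (simp add: sum_pairs_def algebra_simps)
    qed
  qed
  show ?thesis by (rule equalityI; rule subrelI; erule sub1 sub2)
qed

section \<open>From counting pairs to solvability of exponential equations\<close>

lemma card_at_most_one:
  assumes "\<And>j k. P j \<Longrightarrow> P k \<Longrightarrow> j = k"
  shows "finite {k. P k}" "card {k. P k} = of_bool (\<exists>k. P k)"
proof -
  have "{k. P k} = {} \<or> (\<exists>k. {k. P k} = {k})" using assms by blast
  then show "finite {k. P k}" "card {k. P k} = of_bool (\<exists>k. P k)" by auto
qed

text \<open>Each of the four equations determines its exponent \<open>k\<close>, so each set of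
  solutions has size 0 or 1.\<close>

lemma M_prime_powers:
  fixes p :: nat
  assumes p: "prime p" "odd p" and rs: "r > 0" "s > 0"
  shows "M (2 ^ r * int p ^ s) = 5 +
    2 * (of_bool (\<exists>k>0. 2 ^ k = p ^ s + 1) + of_bool (\<exists>k>0. p ^ k = 2 ^ r + 1)) +
    2 * (of_bool (\<exists>k>0. p ^ s = 2 ^ k + 1) + of_bool (\<exists>k>0. 2 ^ r = p ^ k + 1))"
proof -
  have p3: "p \<ge> 3" using odd_prime_ge_3 p by blast
  obtain r' where r': "r = Suc r'" using rs(1) by (cases r) auto
  define e where "e = 2 ^ r' * p ^ s"
  have e: "2 * e = 2 ^ r * p ^ s" unfolding e_def r' by simp
  have d: "2 ^ r * int p ^ s = 2 * int e" using arg_cong[OF e, of int] by simp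
  have "p ^ s \<ge> p" using rs(2) p3 by (simp add: self_le_power)
  moreover have "e \<ge> p ^ s" unfolding e_def by simp
  ultimately have e2: "e \<ge> 2" using p3 by simp
  \<comment> \<open>The two shapes of pairs differ in their first component, by parity, so their
    counts add.\<close>
  have ne: "(2::nat) ^ r \<noteq> p ^ s" using p(2) rs(1) by (metis even_power even_numeral)
  have i2: "j = k" if "(2::nat) ^ j = 2 ^ k" for j k using that by simp
  have ip: "j = k" if "p ^ j = p ^ k" for j k using that p3 by simp
  have c: "finite {k. k > 0 \<and> 2 ^ k = p ^ s + 1}" "finite {k. k > 0 \<and> p ^ k = 2 ^ r + 1}"
    "finite {k. k > 0 \<and> p ^ s = 2 ^ k + 1}" "finite {k. k > 0 \<and> 2 ^ r = p ^ k + 1}"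
    "card {k. k > 0 \<and> 2 ^ k = p ^ s + 1} = of_bool (\<exists>k>0. 2 ^ k = p ^ s + 1)"
    "card {k. k > 0 \<and> p ^ k = 2 ^ r + 1} = of_bool (\<exists>k>0. p ^ k = 2 ^ r + 1)"
    "card {k. k > 0 \<and> p ^ s = 2 ^ k + 1} = of_bool (\<exists>k>0. p ^ s = 2 ^ k + 1)"
    "card {k. k > 0 \<and> 2 ^ r = p ^ k + 1} = of_bool (\<exists>k>0. 2 ^ r = p ^ k + 1)"
    by (rule card_at_most_one; metis i2 ip add_right_cancel)+
  have inj: "inj_on (\<lambda>k. (2 ^ r, 2 ^ r * 2 ^ k :: nat)) A" "inj_on (\<lambda>k. (p ^ s, p ^ s * p ^ k)) A" for A
    using p3 by (auto simp: inj_on_def)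
  have card_image_Un: "card ((\<lambda>k. (2 ^ r, 2 ^ r * 2 ^ k)) ` A \<union> (\<lambda>k. (p ^ s, p ^ s * p ^ k)) ` B)
      = card A + card B" if "finite A" "finite B" for A B
    using that ne by (subst card_Un_disjoint) (auto simp: card_image inj)
  have fin: "finite (diff_pairs (2 * e))" "finite (sum_pairs (2 * e))"
    unfolding e diff_pairs_prime_powers[OF p rs] sum_pairs_prime_powers[OF p rs]
    using c by blast+
  show ?thesis
    unfolding d M_eq_card_pairs[OF e2 fin]
    unfolding e diff_pairs_prime_powers[OF p rs] sum_pairs_prime_powers[OF p rs]
      card_image_Un[OF c(1,2)] card_image_Un[OF c(3,4)] c by (rule refl)
qed

section \<open>Solving the four exponential equations\<close>

lemma mersenne_equation_iff:
  assumes "prime p" "odd p" "s > 0"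
  shows "(\<exists>k>0. 2 ^ k = p ^ s + 1) \<longleftrightarrow> s = 1 \<and> mersenne_prime p"
proof (cases "s = 1")
  case True
  have "p = 2 ^ k - 1 \<longleftrightarrow> 2 ^ k = p + 1" for k
    using prime_gt_0_nat[OF assms(1)] by auto
  then show ?thesis using True assms(1) by (simp add: mersenne_prime_def)
next
  case False
  then show ?thesis
    using power_two_eq_power_plus_one[OF assms(2) odd_prime_ge_3[OF assms(1,2)] assms(3)] by blast
qed

text \<open>For \<open>s = 1\<close> this is the definition of a Fermat prime; the extra case is
  \<open>9 = 8 + 1\<close>.\<close>

lemma fermat_equation_iff:
  assumes "prime p" "odd p" "s > 0"
  shows "(\<exists>k>0. p ^ s = 2 ^ k + 1) \<longleftrightarrow> s = 1 \<and> fermat_prime p \<or> s = 2 \<and> p = 3"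
proof (cases "s = 1")
  case True
  then show ?thesis using assms(1) by (simp add: fermat_prime_def)
next
  case False
  have "\<exists>k>0. (3::nat) ^ 2 = 2 ^ k + 1" by (rule exI[of _ 3]) simp
  then show ?thesis
    using False power_eq_power_two_plus_one[OF assms(2) odd_prime_ge_3[OF assms(1,2)] assms(3)] by blast
qed

text \<open>Here \<open>r\<close> is given and the exponent of \<open>p\<close> is sought: it is 1,
  except that \<open>9 = 8 + 1\<close> allows 2 when \<open>r = 3\<close>.\<close>

lemma power_two_plus_one_is_power_iff:
  fixes p :: nat
  assumes "prime p" "odd p"
  shows "(\<exists>k>0. p ^ k = 2 ^ r + 1) \<longleftrightarrow> p = 2 ^ r + 1 \<or> p = 3 \<and> r = 3"
proof -
  have "p \<ge> 3" using odd_prime_ge_3 assms by blast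
  moreover have "\<exists>k>0. (3::nat) ^ k = 2 ^ 3 + 1" by (rule exI[of _ 2]) simp
  moreover have "\<exists>k>0. p ^ k = 2 ^ r + 1" if "p = 2 ^ r + 1" by (rule exI[of _ 1]) (simp add: that)
  ultimately show ?thesis using power_eq_power_two_plus_one[OF assms(2)]
    by (metis power_one_right)
qed

lemma power_two_minus_one_is_power_iff:
  fixes p :: nat
  assumes "prime p" "odd p"
  shows "(\<exists>k>0. 2 ^ r = p ^ k + 1) \<longleftrightarrow> p = 2 ^ r - 1"
proof -
  have "p \<ge> 3" using odd_prime_ge_3 assms by blast
  moreover have "p = 2 ^ r - 1 \<longleftrightarrow> 2 ^ r = p + 1" by auto
  ultimately show ?thesis using power_two_eq_power_plus_one[OF assms(2)]
    by (metis power_one_right zero_less_one)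
qed

text \<open>Both forms together give \<open>2 ^ k = 2 ^ j + 2\<close>. As \<open>p \<ge> 5\<close>
  forces \<open>j \<ge> 2\<close>, 4 divides both powers, a contradiction. The prime 3 does have
  both forms.\<close>

lemma not_fermat_and_mersenne:
  fixes p :: nat
  assumes "p \<ge> 5" "p = 2 ^ j + 1"
  shows "p \<noteq> 2 ^ k - 1"
proof
  assume "p = 2 ^ k - 1"
  then have eq: "2 ^ k = 2 ^ j + (2::nat)" using assms by simp
  have "j \<ge> 2"
  proof (rule ccontr)
    assume "\<not> j \<ge> 2"
    then have "j = 0 \<or> j = 1" by auto
    then show False using assms by auto
  qed
  moreover have "(2::nat) ^ j < 2 ^ k" using eq by simp
  then have "j < k" by (simp add: power_strict_increasing_iff)
  ultimately have "4 dvd (2::nat) ^ j" "4 dvd (2::nat) ^ k"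
    using le_imp_power_dvd[of 2 j "2::nat"] le_imp_power_dvd[of 2 k "2::nat"] by simp_all
  then show False using eq by presburger
qed

lemma M_prime_powers_explicit:
  assumes "prime p" "odd p" "r > 0" "s > 0"
  shows "M (2 ^ r * int p ^ s) = 5 +
    2 * (of_bool (s = 1 \<and> mersenne_prime p) + of_bool (p = 2 ^ r + 1 \<or> p = 3 \<and> r = 3)) +
    2 * (of_bool (s = 1 \<and> fermat_prime p \<or> s = 2 \<and> p = 3) + of_bool (p = 2 ^ r - 1))"
  unfolding M_prime_powers[OF assms] mersenne_equation_iff[OF assms(1,2,4)]
    fermat_equation_iff[OF assms(1,2,4)] power_two_plus_one_is_power_iff[OF assms(1,2)]
    power_two_minus_one_is_power_iff[OF assms(1,2)]
  by (rule refl)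

theorem theorem4p3:
  shows "(\<forall>r s :: nat. r > 0 \<longrightarrow> s > 0 \<longrightarrow>
            (1 \<le> r \<and> r \<le> 3 \<longrightarrow>
               (s = 1 \<longrightarrow> M (2 ^ r * 3 ^ s) = 11) \<and>
               (s = 2 \<longrightarrow> M (2 ^ r * 3 ^ s) = 9) \<and>
               (s \<ge> 3 \<longrightarrow> M (2 ^ r * 3 ^ s) = 7)) \<and>
            (r \<ge> 4 \<longrightarrow>
               (s = 1 \<longrightarrow> M (2 ^ r * 3 ^ s) = 9) \<and>
               (s = 2 \<longrightarrow> M (2 ^ r * 3 ^ s) = 7) \<and>
               (s \<ge> 3 \<longrightarrow> M (2 ^ r * 3 ^ s) = 5)))
       \<and> (\<forall>p r s :: nat. prime p \<longrightarrow> p \<ge> 5 \<longrightarrow> r > 0 \<longrightarrow> s > 0 \<longrightarrow>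
            (s = 1 \<and> (p = 2 ^ r + 1 \<or> p = 2 ^ r - 1) \<longrightarrow> M (2 ^ r * int p ^ s) = 9) \<and>
            (s \<ge> 2 \<and> (p = 2 ^ r + 1 \<or> p = 2 ^ r - 1) \<longrightarrow> M (2 ^ r * int p ^ s) = 7) \<and>
            (s = 1 \<and> (fermat_prime p \<and> p \<noteq> 2 ^ r + 1 \<or> mersenne_prime p \<and> p \<noteq> 2 ^ r - 1)
               \<longrightarrow> M (2 ^ r * int p ^ s) = 7) \<and>
            (\<not> (s = 1 \<and> (p = 2 ^ r + 1 \<or> p = 2 ^ r - 1)) \<and>
             \<not> (s \<ge> 2 \<and> (p = 2 ^ r + 1 \<or> p = 2 ^ r - 1)) \<and>
             \<not> (s = 1 \<and> (fermat_prime p \<and> p \<noteq> 2 ^ r + 1 \<or> mersenne_prime p \<and> p \<noteq> 2 ^ r - 1))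
               \<longrightarrow> M (2 ^ r * int p ^ s) = 5))"
proof -
  \<comment> \<open>The conditions on \<open>r\<close> come from \<open>3 = 2 + 1\<close>,
    \<open>9 = 8 + 1\<close> and \<open>3 = 4 - 1\<close>; exactly one holds for
    \<open>r \<le> 3\<close> and none for \<open>r \<ge> 4\<close>. Both indicators for
    \<open>s = 1\<close> count, as 3 is Fermat and Mersenne.\<close>
  have three: "M (2 ^ r * 3 ^ s) = 5 + 2 * (of_bool (s = 1) + of_bool (r = 1 \<or> r = 3)) +
      2 * (of_bool (s = 1 \<or> s = 2) + of_bool (r = 2))" if "r > 0" "s > 0" for r s :: nat
  proof -
    have "fermat_prime 3" unfolding fermat_prime_def by (auto intro!: exI[of _ 1])
    moreover have "mersenne_prime 3" unfolding mersenne_prime_def by (auto intro!: exI[of _ 2])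
    moreover have "3 = 2 ^ r + (1::nat) \<longleftrightarrow> r = 1"
      using power_inject_exp[of "2::nat" r 1] by auto
    moreover have "3 = 2 ^ r - (1::nat) \<longleftrightarrow> r = 2"
      using power_inject_exp[of "2::nat" r 2] by auto
    ultimately show ?thesis using M_prime_powers_explicit[of 3 r s] that by simp
  qed
  have large: "M (2 ^ r * int p ^ s) = 5 +
      2 * (of_bool (s = 1 \<and> mersenne_prime p) + of_bool (p = 2 ^ r + 1)) +
      2 * (of_bool (s = 1 \<and> fermat_prime p) + of_bool (p = 2 ^ r - 1))"
    if "prime p" "p \<ge> 5" "r > 0" "s > 0" for p r s :: nat
  proof -
    have "odd p" using that(1,2) prime_odd_nat by simp
    then show ?thesis using M_prime_powers_explicit[of p r s] that by simp
  qed
  have fermat: "fermat_prime p" if "prime p" "r > 0" "p = 2 ^ r + 1" for p r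
    using that unfolding fermat_prime_def by blast
  have mersenne: "mersenne_prime p" if "prime p" "r > 0" "p = 2 ^ r - 1" for p r
    using that unfolding mersenne_prime_def by blast
  \<comment> \<open>This caps the value at 9: at most one indicator depending on \<open>r\<close>
    and one depending on \<open>s\<close> can hold.\<close>
  have excl: "\<not> (fermat_prime p \<and> mersenne_prime p)" if "p \<ge> 5" for p
    using not_fermat_and_mersenne[OF that] unfolding fermat_prime_def mersenne_prime_def by blast
  have part1: "(1 \<le> r \<and> r \<le> 3 \<longrightarrow>
               (s = 1 \<longrightarrow> M (2 ^ r * 3 ^ s) = 11) \<and>
               (s = 2 \<longrightarrow> M (2 ^ r * 3 ^ s) = 9) \<and>
               (s \<ge> 3 \<longrightarrow> M (2 ^ r * 3 ^ s) = 7)) \<and>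
            (r \<ge> 4 \<longrightarrow>
               (s = 1 \<longrightarrow> M (2 ^ r * 3 ^ s) = 9) \<and>
               (s = 2 \<longrightarrow> M (2 ^ r * 3 ^ s) = 7) \<and>
               (s \<ge> 3 \<longrightarrow> M (2 ^ r * 3 ^ s) = 5))" if "r > 0" "s > 0" for r s :: nat
  proof -
    consider "r = 1" | "r = 2" | "r = 3" | "r \<ge> 4" using \<open>r > 0\<close> by linarith
    then show ?thesis unfolding three[OF that] by cases auto
  qed
  have part2: "(s = 1 \<and> (p = 2 ^ r + 1 \<or> p = 2 ^ r - 1) \<longrightarrow> M (2 ^ r * int p ^ s) = 9) \<and>
            (s \<ge> 2 \<and> (p = 2 ^ r + 1 \<or> p = 2 ^ r - 1) \<longrightarrow> M (2 ^ r * int p ^ s) = 7) \<and>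
            (s = 1 \<and> (fermat_prime p \<and> p \<noteq> 2 ^ r + 1 \<or> mersenne_prime p \<and> p \<noteq> 2 ^ r - 1)
               \<longrightarrow> M (2 ^ r * int p ^ s) = 7) \<and>
            (\<not> (s = 1 \<and> (p = 2 ^ r + 1 \<or> p = 2 ^ r - 1)) \<and>
             \<not> (s \<ge> 2 \<and> (p = 2 ^ r + 1 \<or> p = 2 ^ r - 1)) \<and>
             \<not> (s = 1 \<and> (fermat_prime p \<and> p \<noteq> 2 ^ r + 1 \<or> mersenne_prime p \<and> p \<noteq> 2 ^ r - 1))
               \<longrightarrow> M (2 ^ r * int p ^ s) = 5)"
    if "prime p" "p \<ge> 5" "r > 0" "s > 0" for p r s :: nat
  proof -
    have "s = 1 \<or> s \<ge> 2" using \<open>s > 0\<close> by linarith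
    then show ?thesis unfolding large[OF that]
      using fermat[OF that(1,3)] mersenne[OF that(1,3)] excl[OF that(2)]
      by (cases "p = 2 ^ r + 1"; cases "p = 2 ^ r - 1"; cases "fermat_prime p"; cases "mersenne_prime p";
          simp only: ; auto)
  qed
  show ?thesis using part1 part2 by blast
qed

end
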